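(* Define $\rho_1=1/2-\rho$, where $\rho$ is the branching parameter of the algebroid solution. The group $\mathcal{D}_{1,2}(s_0)$ is finite if and only if $s_0$ is an algebraic number that can be written in the form $s_0=1+2\cos(2\pi\rho_1)$, with $\rho_1\in\mathbb{Q}$ such that $0<2\rho_1<1$. In this case, the length of the orbit of the normal subgroup $\mathcal{N}_{1,2}$ coincides with the denominator of $\rho_1$ in its representation as an irreducible fraction.
   Context: Consider the degenerate third Painlevé equation $u''=\frac{(u')^2}{u}-\frac{u'}{\tau}+\frac1\tau(-8\varepsilon u^2+2ab)+\frac{b^2}{u}$ with $a=0$ ($\varepsilon=\pm1$, $\varepsilon b>0$). Its algebroid solutions behave as $u(\tau)\sim c\,\tau^{1-4\rho}$ as $\tau\to0$, with $c\in\mathbb{C}\setminus\{0\}$ and branching parameter $\rho$ given by $2\rho=\frac{1}{1+2q}$, $q$ a positive rational number. The solutions are parametrized by the contracted monodromy manifold, the surface in $\mathbb{C}^4$ with coordinates $(x,y,z,s)$ given by $$x+y+z(1-s)=1,\qquad z(z-1)=xy.$$ The transformations $$r_1:(x,y,z,s)\mapsto(y,x,z,s),\qquad r_2:(x,y,z,s)\mapsto(z,\;y+(x-z)s,\;x,\;s)$$ of $\mathbb{C}^4$ are involutions and preserve this surface. $\mathcal{D}_{1,2}$ denotes the dihedral group generated by $\{r_1,r_2\}$, and $\mathcal{N}_{1,2}$ denotes its normal subgroup with generator $r_1r_2$. Since the action of $\mathcal{D}_{1,2}$ does not change the fourth coordinate, $s$ can be treated as a parameter: $\mathcal{D}_{1,2}(s_0)$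 denotes the action of $\mathcal{D}_{1,2}$ in $\mathbb{C}^3$ (coordinates $x,y,z$), regarded as the hyperplane $s=s_0$ in $\mathbb{C}^4$. *)

theory Defs
  imports
    Complex_Main
    "HOL-Computational_Algebra.Polynomial"
    "HOL-Algebra.Bij"
    "HOL-Algebra.Generated_Groups"
    "HOL-Algebra.Group_Action"
begin

type_synonym C3 = "complex \<times> complex \<times> complex"
type_synonym C4 = "complex \<times> complex \<times> complex \<times> complex"

text \<open>The values of the branching parameter \<open>\<rho>\<close> of the algebroid solutions
  \<open>u(\<tau>) \<sim> c \<tau>^(1 - 4\<rho>)\<close> (\<open>\<tau> \<rightarrow> 0\<close>) of the degenerate third Painleve equation with \<open>a = 0\<close>;
  \<open>\<rho>\<close> is determined by a positive rational \<open>q\<close>.\<close>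

definition branching_parameter :: "rat \<Rightarrow> bool" where
  "branching_parameter \<rho> \<longleftrightarrow> (\<exists>q::rat. q > 0 \<and> 2 * \<rho> = 1 / (1 + 2 * q))"

text \<open>Hence \<open>\<rho>\<^sub>1 = 1/2 - \<rho>\<close> runs through all rationals with \<open>0 < 2\<rho>\<^sub>1 < 1\<close>.\<close>

lemma branching_parameter_iff:
  "branching_parameter (1 / 2 - \<rho>\<^sub>1) \<longleftrightarrow> 0 < 2 * \<rho>\<^sub>1 \<and> 2 * \<rho>\<^sub>1 < 1"
proof
  assume "branching_parameter (1 / 2 - \<rho>\<^sub>1)"
  then obtain q where q: "q > 0" and e: "2 * (1 / 2 - \<rho>\<^sub>1) = 1 / (1 + 2 * q)"
    by (auto simp: branching_parameter_def)
  have "0 < 1 / (1 + 2 * q)" and "1 / (1 + 2 * q) < 1"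
    using q by (auto simp: field_simps)
  moreover have "1 / (1 + 2 * q) = 1 - 2 * \<rho>\<^sub>1"
    using e by (simp add: right_diff_distrib)
  ultimately have "0 < 1 - 2 * \<rho>\<^sub>1" and "1 - 2 * \<rho>\<^sub>1 < 1" by metis+
  then show "0 < 2 * \<rho>\<^sub>1 \<and> 2 * \<rho>\<^sub>1 < 1" by simp
next
  assume h: "0 < 2 * \<rho>\<^sub>1 \<and> 2 * \<rho>\<^sub>1 < 1"
  let ?q = "\<rho>\<^sub>1 / (1 - 2 * \<rho>\<^sub>1)"
  have "?q > 0" and "2 * (1 / 2 - \<rho>\<^sub>1) = 1 / (1 + 2 * ?q)"
    using h by (auto simp: field_simps)
  then show "branching_parameter (1 / 2 - \<rho>\<^sub>1)"
    unfolding branching_parameter_def by blast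
qed

definition monodromy_surface :: "C4 set" where
  "monodromy_surface = {(x, y, z, s). x + y + z * (1 - s) = 1 \<and> z * (z - 1) = x * y}"

definition r1 :: "C4 \<Rightarrow> C4" where
  "r1 = (\<lambda>(x, y, z, s). (y, x, z, s))"

definition r2 :: "C4 \<Rightarrow> C4" where
  "r2 = (\<lambda>(x, y, z, s). (z, y + (x - z) * s, x, s))"

definition D12 :: "(C4 \<Rightarrow> C4) monoid" where
  "D12 = subgroup_generated (BijGroup UNIV) {r1, r2}"

definition N12 :: "(C4 \<Rightarrow> C4) monoid" where
  "N12 = subgroup_generated (BijGroup UNIV) {r1 \<circ> r2}"

text \<open>\<^const>\<open>subgroup_generated\<close> intersects the generating set with the carrier, so it matters
  that the generators are bijections.\<close>

lemma r1_r1 [simp]: "r1 (r1 p) = p"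
  by (cases p) (simp add: r1_def)

lemma r2_r2 [simp]: "r2 (r2 p) = p"
  by (cases p) (simp add: r2_def algebra_simps)

lemma generators_in_BijGroup:
  "r1 \<in> carrier (BijGroup UNIV)" "r2 \<in> carrier (BijGroup UNIV)"
  "r1 \<circ> r2 \<in> carrier (BijGroup UNIV)"
proof -
  have "bij r1" "bij r2" by (auto intro: involuntory_imp_bij)
  then show "r1 \<in> carrier (BijGroup UNIV)" "r2 \<in> carrier (BijGroup UNIV)"
    "r1 \<circ> r2 \<in> carrier (BijGroup UNIV)"
    by (auto simp: BijGroup_def Bij_def bij_comp)
qed

text \<open>Action on \<open>\<complex>\<^sup>3\<close> regarded as the hyperplane \<open>s = s\<^sub>0\<close>. Dropping the last coordinate loses
  nothing for the elements of \<^const>\<open>D12\<close>, which leave it unchanged.\<close>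

definition slice :: "complex \<Rightarrow> (C4 \<Rightarrow> C4) \<Rightarrow> C3 \<Rightarrow> C3" where
  "slice s\<^sub>0 g = (\<lambda>(x, y, z). case g (x, y, z, s\<^sub>0) of (x', y', z', s') \<Rightarrow> (x', y', z'))"

definition D12_at :: "complex \<Rightarrow> (C3 \<Rightarrow> C3) set" where
  "D12_at s\<^sub>0 = slice s\<^sub>0 ` carrier D12"

definition N12_at :: "complex \<Rightarrow> (C3 \<Rightarrow> C3) set" where
  "N12_at s\<^sub>0 = slice s\<^sub>0 ` carrier N12"

definition denominator :: "rat \<Rightarrow> nat" where
  "denominator r = nat (snd (quotient_of r))"

end

theory Submission
  imports Defs
begin

text \<open>On the hyperplane \<open>s = s\<^sub>0\<close> the product \<open>r\<^sub>1r\<^sub>2\<close> is linear with characteristic polynomial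
  \<open>(\<lambda> - 1) (\<lambda>\<^sup>2 + (1 - s\<^sub>0) \<lambda> + 1)\<close>, so its eigenvalues are \<open>1\<close>, \<open>w\<close>, \<open>w\<inverse>\<close> with
  \<open>s\<^sub>0 = 1 + w + w\<inverse>\<close>. It is diagonalizable unless \<open>w = \<plusminus>1\<close>, when it has a Jordan block and
  infinite order; hence the group is finite iff \<open>w\<close> is a root of unity other than \<open>\<plusminus>1\<close>, that is
  \<open>w = exp (\<plusminus>2\<pi>i\<rho>\<^sub>1)\<close>, and the order of \<open>r\<^sub>1r\<^sub>2\<close> is then that of \<open>w\<close>, the denominator of \<open>\<rho>\<^sub>1\<close>.
  The fixed points are \<open>(t, t, t)\<close>, none of which lies on the surface, so every orbit on the surface
  has full length.\<close>

section \<open>Subgroups of the group of bijections\<close>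

lemma mult_BijGroup_UNIV:
  assumes "g \<in> carrier (BijGroup UNIV)" "h \<in> carrier (BijGroup UNIV)"
  shows "g \<otimes>\<^bsub>BijGroup UNIV\<^esub> h = g \<circ> h"
  using assms by (simp add: BijGroup_def compose_def fun_eq_iff)

text \<open>Reduces claims about the generated group to bare functions under composition;
  \<open>generate\<close> inverts generators only, so inverses are treated only there.\<close>

lemma generate_BijGroup_induct:
  assumes g: "g \<in> carrier (subgroup_generated (BijGroup UNIV) A)"
    and one: "P id"
    and gen: "\<And>a. a \<in> A \<Longrightarrow> P a"
    and inv: "\<And>a. a \<in> A \<Longrightarrow> P (inv_into UNIV a)"
    and comp: "\<And>g h. P g \<Longrightarrow> P h \<Longrightarrow> P (g \<circ> h)"
  shows "P g"
proof -
  interpret G: group "BijGroup UNIV" by (rule group_BijGroup)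
  have "g \<in> generate (BijGroup UNIV) (carrier (BijGroup UNIV) \<inter> A)"
    using g by (simp add: carrier_subgroup_generated)
  then show ?thesis
  proof induction
    case one
    then show ?case using assms(2) by (simp add: BijGroup_def id_def)
  next
    case (incl h)
    then show ?case using gen by blast
  next
    case (inv h)
    then have "h \<in> Bij UNIV" by (simp add: BijGroup_def)
    then have "m_inv (BijGroup UNIV) h = inv_into UNIV h" by (simp add: inv_BijGroup restrict_def)
    then show ?case using inv assms(4) by simp
  next
    case (eng h k)
    then have "h \<in> carrier (BijGroup UNIV)" "k \<in> carrier (BijGroup UNIV)"
      by (blast intro: G.generate_in_carrier[OF Int_lower1])+
    then have "h \<otimes>\<^bsub>BijGroup UNIV\<^esub> k = h \<circ> k" by (rule mult_BijGroup_UNIV)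
    then show ?case using comp eng.IH by metis
  qed
qed

lemma comp_in_generated_BijGroup:
  assumes "g \<in> carrier (subgroup_generated (BijGroup UNIV) A)"
    and "h \<in> carrier (subgroup_generated (BijGroup UNIV) A)"
  shows "g \<circ> h \<in> carrier (subgroup_generated (BijGroup UNIV) A)"
proof -
  interpret G: group "BijGroup UNIV" by (rule group_BijGroup)
  have "g \<in> carrier (BijGroup UNIV)" "h \<in> carrier (BijGroup UNIV)"
    using assms unfolding carrier_subgroup_generated
    by (blast intro: G.generate_in_carrier[OF Int_lower1])+
  then have "g \<otimes>\<^bsub>BijGroup UNIV\<^esub> h = g \<circ> h" by (rule mult_BijGroup_UNIV)
  moreover have "g \<otimes>\<^bsub>BijGroup UNIV\<^esub> h \<in> carrier (subgroup_generated (BijGroup UNIV) A)"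
    using assms by (auto simp: carrier_subgroup_generated intro: generate.eng)
  ultimately show ?thesis by simp
qed

lemma funpow_in_generated_BijGroup:
  fixes g :: "'a \<Rightarrow> 'a"
  assumes "g \<in> carrier (subgroup_generated (BijGroup UNIV) A)"
  shows "g ^^ k \<in> carrier (subgroup_generated (BijGroup UNIV) A)"
proof (induction k)
  case 0
  have "\<one>\<^bsub>BijGroup UNIV\<^esub> \<in> carrier (subgroup_generated (BijGroup UNIV) A)"
    by (simp add: carrier_subgroup_generated generate.one)
  moreover have "\<one>\<^bsub>BijGroup UNIV\<^esub> = (id :: 'a \<Rightarrow> 'a)"
    by (simp add: BijGroup_def id_def restrict_def)
  ultimately show ?case by (simp add: id_def)
next
  case (Suc k)
  then show ?case
    unfolding funpow.simps using assms by (intro comp_in_generated_BijGroup)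
qed

section \<open>Restriction to a hyperplane of constant fourth coordinate\<close>

definition preserves_s :: "(C4 \<Rightarrow> C4) \<Rightarrow> bool" where
  "preserves_s g \<longleftrightarrow> (\<forall>x y z s. snd (snd (snd (g (x, y, z, s)))) = s)"

lemma preserves_s_simps [simp]:
  "preserves_s id" "preserves_s r1" "preserves_s r2"
  by (simp_all add: preserves_s_def r1_def r2_def)

lemma preserves_s_comp [simp]:
  "preserves_s g \<Longrightarrow> preserves_s h \<Longrightarrow> preserves_s (g \<circ> h)"
  unfolding preserves_s_def by (metis comp_apply prod.collapse)

lemma preserves_s_funpow [simp]: "preserves_s g \<Longrightarrow> preserves_s (g ^^ k)"
  by (induction k) simp_all

lemma slice_id [simp]: "slice s id = id"
  by (auto simp: slice_def)

text \<open>The right-hand side resets the fourth coordinate to \<open>s\<close> between the two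
  maps; this is harmless because \<open>h\<close> has not changed it.\<close>

lemma slice_comp:
  assumes "preserves_s h"
  shows "slice s (g \<circ> h) = slice s g \<circ> slice s h"
proof
  fix p :: C3
  obtain x y z where p: "p = (x, y, z)" by (cases p)
  obtain x' y' z' s' where h: "h (x, y, z, s) = (x', y', z', s')"
    by (cases "h (x, y, z, s)")
  with assms have "s' = s"
    unfolding preserves_s_def by (metis snd_conv)
  then show "slice s (g \<circ> h) p = (slice s g \<circ> slice s h) p"
    using p h by (simp add: slice_def)
qed

lemma slice_funpow: "preserves_s g \<Longrightarrow> slice s (g ^^ k) = slice s g ^^ k"
  by (induction k) (simp_all add: slice_comp)

definition turn :: "complex \<Rightarrow> C3 \<Rightarrow> C3" where
  "turn s = slice s (r1 \<circ> r2)"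

definition flip :: "C3 \<Rightarrow> C3" where
  "flip = (\<lambda>(x, y, z). (y, x, z))"

lemma turn_apply [simp]: "turn s (x, y, z) = (y + (x - z) * s, z, x)"
  by (simp add: turn_def slice_def r1_def r2_def)

lemma slice_r1: "slice s r1 = flip"
  by (auto simp: slice_def r1_def flip_def)

lemma flip_flip [simp]: "flip (flip p) = p"
  by (cases p) (simp add: flip_def)

lemma slice_r2: "slice s r2 = flip \<circ> turn s"
  by (auto simp: slice_def r2_def flip_def fun_eq_iff)

lemma inv_r1: "inv_into UNIV r1 = r1" and inv_r2: "inv_into UNIV r2 = r2"
  by (rule inv_unique_comp; simp add: fun_eq_iff)+

lemma inv_r1_r2: "inv_into UNIV (r1 \<circ> r2) = r2 \<circ> r1"
  by (rule inv_unique_comp; simp add: fun_eq_iff)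

text \<open>The dihedral relation: conjugating the rotation by the reflection inverts it.\<close>

lemma turn_flip_turn: "turn s (flip (turn s p)) = flip p"
  by (cases p) (simp add: flip_def algebra_simps)

lemma inj_turn: "inj (turn s)"
  by (rule inj_on_inverseI[of _ "flip \<circ> turn s \<circ> flip"])
    (simp add: turn_flip_turn)

lemma turn_funpow_in_N12_at: "turn s ^^ k \<in> N12_at s"
proof -
  have "r1 \<circ> r2 \<in> carrier N12"
    using generators_in_BijGroup by (simp add: N12_def carrier_subgroup_generated generate.incl)
  then have "(r1 \<circ> r2) ^^ k \<in> carrier N12"
    unfolding N12_def by (rule funpow_in_generated_BijGroup)
  moreover have "slice s ((r1 \<circ> r2) ^^ k) = turn s ^^ k"
    by (simp add: slice_funpow turn_def)
  ultimately show ?thesis unfolding N12_at_def by (metis imageI)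
qed

lemma turn_funpow_in_D12_at: "turn s ^^ k \<in> D12_at s"
proof -
  have "r1 \<in> carrier D12" "r2 \<in> carrier D12"
    using generators_in_BijGroup by (simp_all add: D12_def carrier_subgroup_generated generate.incl)
  then have "(r1 \<circ> r2) ^^ k \<in> carrier D12"
    unfolding D12_def by (intro funpow_in_generated_BijGroup comp_in_generated_BijGroup)
  moreover have "slice s ((r1 \<circ> r2) ^^ k) = turn s ^^ k"
    by (simp add: slice_funpow turn_def)
  ultimately show ?thesis unfolding D12_at_def by (metis imageI)
qed

section \<open>Dihedral normal forms\<close>

lemma funpow_periodic:
  assumes "f ^^ n = id" "0 < n"
  shows "range (\<lambda>k. f ^^ k) = (\<lambda>k. f ^^ k) ` {..<n}"
proof -
  have "f ^^ k = f ^^ (k mod n)" for k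
  proof -
    have "f ^^ k = (f ^^ n) ^^ (k div n) \<circ> f ^^ (k mod n)"
      by (simp only: funpow_mult funpow_add[symmetric] mult_div_mod_eq)
    then show ?thesis using assms by simp
  qed
  moreover have "k mod n \<in> {..<n}" for k using assms(2) by simp
  ultimately show ?thesis by (intro antisym image_subsetI) (metis imageI, blast)
qed

text \<open>A period makes the inverse of \<open>turn s\<close> a natural power, so nonnegative
  exponents suffice to describe both groups.\<close>

lemma turn_inverse:
  assumes "turn s ^^ n = id" "0 < n"
  shows "flip \<circ> turn s \<circ> flip = turn s ^^ (n - 1)"
proof
  fix p
  have "turn s ((flip \<circ> turn s \<circ> flip) p) = p" by (simp add: turn_flip_turn)
  also have "p = (turn s ^^ Suc (n - 1)) p" using assms by simp
  also have "\<dots> = turn s ((turn s ^^ (n - 1)) p)" by simp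
  finally show "(flip \<circ> turn s \<circ> flip) p = (turn s ^^ (n - 1)) p"
    using inj_turn by (metis injD)
qed

lemma N12_at_periodic:
  assumes "turn s ^^ n = id" "0 < n"
  shows "N12_at s = range (\<lambda>k. turn s ^^ k)"
proof
  show "range (\<lambda>k. turn s ^^ k) \<subseteq> N12_at s" by (auto intro: turn_funpow_in_N12_at)
  show "N12_at s \<subseteq> range (\<lambda>k. turn s ^^ k)"
  proof
    fix f assume "f \<in> N12_at s"
    then obtain g where g: "g \<in> carrier N12" and f: "f = slice s g"
      by (auto simp: N12_at_def)
    \<comment> \<open>The invariant carries \<open>preserves_s\<close> because
      \<open>slice_comp\<close> asks for it in the composition case.\<close>
    define P where "P g \<longleftrightarrow> preserves_s g \<and> slice s g \<in> range (\<lambda>k. turn s ^^ k)" for g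
    have "P g"
      using g unfolding N12_def
    proof (rule generate_BijGroup_induct)
      show "P id" unfolding P_def by (auto intro: rev_image_eqI[of 0])
      show "P a" if "a \<in> {r1 \<circ> r2}" for a
        using that by (auto simp: P_def turn_def[symmetric] intro: rev_image_eqI[of 1])
      show "P (inv_into UNIV a)" if "a \<in> {r1 \<circ> r2}" for a
        using that turn_inverse[OF assms]
        by (auto simp: P_def inv_r1_r2 slice_comp slice_r1 slice_r2)
      show "P (g \<circ> h)" if "P g" "P h" for g h
        using that by (auto simp: P_def slice_comp funpow_add[symmetric])
    qed
    then show "f \<in> range (\<lambda>k. turn s ^^ k)" using f by (simp add: P_def)
  qed
qed

text \<open>Every element has a normal form \<open>turn s ^^ k\<close> or
  \<open>turn s ^^ k \<circ> flip\<close>, and only k modulo n matters.\<close>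

lemma finite_D12_at_periodic:
  assumes "turn s ^^ n = id" "0 < n"
  shows "finite (D12_at s)"
proof -
  let ?R = "range (\<lambda>k. turn s ^^ k)"
  let ?F = "?R \<union> (\<lambda>f. f \<circ> flip) ` ?R"
  have inR: "turn s ^^ k \<in> ?R" for k by blast
  have inF: "turn s ^^ k \<circ> flip \<in> ?F" for k by blast
  have ff: "flip \<circ> flip = id" by (simp add: fun_eq_iff)
  \<comment> \<open>The exponent \<open>(n - 1) * k\<close> stands for -k modulo the period
    n.\<close>
  have push: "flip \<circ> turn s ^^ k = turn s ^^ ((n - 1) * k) \<circ> flip" for k
  proof (induction k)
    case 0 show ?case by simp
  next
    case (Suc k)
    have "flip \<circ> turn s ^^ Suc k = (flip \<circ> turn s \<circ> flip) \<circ> (flip \<circ> turn s ^^ k)"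
      by (simp add: fun_eq_iff)
    also have "\<dots> = turn s ^^ (n - 1) \<circ> turn s ^^ ((n - 1) * k) \<circ> flip"
      unfolding Suc turn_inverse[OF assms] by (simp only: comp_assoc)
    finally show ?case by (simp only: funpow_add[symmetric] mult_Suc_right)
  qed
  define P where "P g \<longleftrightarrow> preserves_s g \<and> slice s g \<in> ?F" for g
  have "slice s g \<in> ?F" if "g \<in> carrier D12" for g
  proof -
    \<comment> \<open>\<open>r1\<close> gives \<open>flip\<close>, the normal form with exponent 0;
      \<open>r2\<close> gives \<open>flip \<circ> turn s\<close>, which \<open>push[of 1]\<close>
      brings to exponent \<open>(n - 1) * 1\<close>.\<close>
    have gen: "P a" if "a \<in> {r1, r2}" for a
      using that inF[of 0] inF[of "(n - 1) * 1"] push[of 1]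
      by (auto simp: P_def slice_r1 slice_r2)
    have "P g"
      using that unfolding D12_def
    proof (rule generate_BijGroup_induct)
      show "P id" using inR[of 0] by (simp add: P_def)
      show "P a" if "a \<in> {r1, r2}" for a by (fact gen[OF that])
      show "P (inv_into UNIV a)" if "a \<in> {r1, r2}" for a
        using gen[OF that] that by (auto simp: inv_r1 inv_r2)
      show "P (g \<circ> h)" if gh: "P g" "P h" for g h
      proof -
        obtain i where i: "slice s g = turn s ^^ i \<or> slice s g = turn s ^^ i \<circ> flip"
          using gh(1) by (auto simp: P_def)
        obtain j where j: "slice s h = turn s ^^ j \<or> slice s h = turn s ^^ j \<circ> flip"
          using gh(2) by (auto simp: P_def)
        \<comment> \<open>If the left factor contains \<open>flip\<close>, it is pushed through the
          right factor, where a second \<open>flip\<close> cancels it.\<close>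
        have *: "(turn s ^^ i \<circ> flip) \<circ> turn s ^^ j = turn s ^^ (i + (n - 1) * j) \<circ> flip"
          using push[of j] by (simp add: comp_assoc funpow_add)
        have **: "(turn s ^^ i \<circ> flip) \<circ> (turn s ^^ j \<circ> flip) = turn s ^^ (i + (n - 1) * j)"
          using * ff by (metis comp_assoc comp_id)
        have "slice s g \<circ> slice s h \<in> ?F"
          using i j * ** inR inF by (elim disjE) (simp_all add: comp_assoc[symmetric] funpow_add[symmetric])
        then show ?thesis using gh by (simp add: P_def slice_comp)
      qed
    qed
    then show ?thesis by (simp add: P_def)
  qed
  then have "D12_at s \<subseteq> ?F" by (auto simp: D12_at_def)
  moreover have "finite ?R" using funpow_periodic[OF assms] by simp
  ultimately show ?thesis by (meson finite_UnI finite_imageI finite_subset)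
qed

section \<open>Eigencovectors of the rotation\<close>

text \<open>Eigencovector of \<^const>\<open>turn\<close> for the eigenvalue \<open>w\<close>, where \<open>s = 1 + w + w\<inverse>\<close>.\<close>

definition eigenform :: "complex \<Rightarrow> C3 \<Rightarrow> complex" where
  "eigenform w = (\<lambda>(x, y, z). w * (x - z) + (y - z))"

text \<open>The linear form of the first surface equation is the eigencovector for the eigenvalue
  1.\<close>

definition surface_form :: "complex \<Rightarrow> C3 \<Rightarrow> complex" where
  "surface_form s = (\<lambda>(x, y, z). x + y + z * (1 - s))"

lemma surface_form_turn: "surface_form s ((turn s ^^ k) p) = surface_form s p"
proof (induction k)
  case (Suc k)
  have "surface_form s (turn s q) = surface_form s q" for q
    by (cases q) (simp add: surface_form_def algebra_simps)
  then show ?case using Suc by simp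
qed simp

context
  fixes w s :: complex
  assumes w0: "w \<noteq> 0" and s: "s = 1 + w + inverse w"
begin

lemma eigenform_turn1: "eigenform w (turn s q) = w * eigenform w q"
  using w0 by (cases q) (simp add: eigenform_def s field_simps)

lemma eigenform_turn: "eigenform w ((turn s ^^ k) p) = w ^ k * eigenform w p"
  by (induction k) (simp_all add: eigenform_turn1)

text \<open>The eigencovectors for w, 1/w and 1 are linearly independent: the first two determine x
  - z and y - z since w differs from 1/w, and the third then determines z since s differs from
  3.\<close>

lemma forms_separate:
  assumes w2: "w\<^sup>2 \<noteq> 1"
    and e: "eigenform w p = eigenform w q"
    and e': "eigenform (inverse w) p = eigenform (inverse w) q"
    and m: "surface_form s p = surface_form s q"
  shows "p = q"
proof -
  obtain x y z where p: "p = (x, y, z)" by (cases p)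
  obtain x' y' z' where q: "q = (x', y', z')" by (cases q)
  have 1: "w * (x - z) + (y - z) = w * (x' - z') + (y' - z')"
    and 2: "inverse w * (x - z) + (y - z) = inverse w * (x' - z') + (y' - z')"
    and 3: "x + y + z * (1 - s) = x' + y' + z' * (1 - s)"
    using e e' m by (simp_all add: p q eigenform_def surface_form_def)
  have "w \<noteq> inverse w"
    using w0 w2 by (metis power2_eq_square right_inverse)
  moreover have "(w - inverse w) * ((x - z) - (x' - z')) = 0"
    using 1 2 by algebra
  ultimately have xz: "x - z = x' - z'" by simp
  with 1 have yz: "y - z = y' - z'" by simp
  \<comment> \<open>\<open>surface_form s\<close> equals
    \<open>(x - z) + (y - z) + (3 - s) * z\<close>.\<close>
  have "(3 - s) * z = (3 - s) * z'"
    using 3 xz yz by algebra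
  moreover have "w * (s - 3) = (w - 1)\<^sup>2"
    using w0 by (simp add: s field_simps power2_eq_square)
  then have "s \<noteq> 3" using w2 by auto
  ultimately have "z = z'" by simp
  then show ?thesis using xz yz p q by simp
qed

text \<open>For \<open>w = \<plusminus>1\<close> the map \<^const>\<open>turn\<close> has a nontrivial Jordan block, visible on
  the difference \<open>x - z\<close>.\<close>

lemma turn_jordan_block:
  assumes "w\<^sup>2 = 1"
  shows "(case (turn s ^^ k) (0, 1, 0) of (x, y, z) \<Rightarrow> w * (x - z)) = of_nat k * w ^ k"
proof (induction k)
  case 0
  show ?case by simp
next
  case (Suc k)
  obtain x y z where xyz: "(turn s ^^ k) (0, 1, 0) = (x, y, z)"
    by (cases "(turn s ^^ k) (0, 1, 0)")
  have inv: "inverse w = w" using assms by (metis inverse_unique power2_eq_square)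
  have e: "w * (x - z) + (y - z) = w ^ k"
    using eigenform_turn[of k "(0, 1, 0)"] xyz by (simp add: eigenform_def)
  have "w * (x - z) = of_nat k * w ^ k" using Suc xyz by simp
  \<comment> \<open>Here \<open>s = 1 + 2 * w\<close>, so the next difference of first and third
    coordinates is the old one times w plus the eigenform, that is, plus \<open>w ^ k\<close>; this
    forcing term causes the linear growth.\<close>
  moreover have "y + (x - z) * s - x = w * (x - z) + (w * (x - z) + (y - z))"
    by (simp add: s inv algebra_simps)
  ultimately have "y + (x - z) * s - x = of_nat k * w ^ k + w ^ k"
    unfolding e by (simp only:)
  then have "w * (y + (x - z) * s - x) = w * (of_nat k * w ^ k + w ^ k)"
    by (simp only:)
  then show ?case using xyz by (simp add: algebra_simps)
qed

text \<open>The test point (0, 1, 0) has eigenform 1, which gives the root of unity; for w =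
  \<plusminus>1 its growth \<open>of_nat k * w ^ k\<close> would have to vanish.\<close>

lemma turn_periodic_imp_root:
  assumes "turn s ^^ k = id" "0 < k"
  shows "w ^ k = 1 \<and> w\<^sup>2 \<noteq> 1"
proof
  show "w ^ k = 1"
    using eigenform_turn[of k "(0, 1, 0)"] assms by (simp add: eigenform_def)
  show "w\<^sup>2 \<noteq> 1"
    using turn_jordan_block[of k] assms w0 by auto
qed

end

text \<open>The relation between s and w is symmetric under exchanging w and 1/w.\<close>

lemma eigenform_inverse_turn:
  assumes "w \<noteq> 0" "s = 1 + w + inverse w"
  shows "eigenform (inverse w) ((turn s ^^ k) p) = inverse w ^ k * eigenform (inverse w) p"
  using assms by (intro eigenform_turn) auto

text \<open>The k-th power acts on each of the three separating covectors by 1.\<close>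

lemma turn_funpow_id:
  assumes "w \<noteq> 0" "s = 1 + w + inverse w" "w\<^sup>2 \<noteq> 1" "w ^ k = 1"
  shows "turn s ^^ k = id"
proof
  fix p
  show "(turn s ^^ k) p = id p"
    using assms(3)
    by (intro forms_separate[OF assms(1,2)])
      (simp_all add: eigenform_turn[OF assms(1,2)] eigenform_inverse_turn[OF assms(1,2)]
        surface_form_turn assms(4) power_inverse)
qed

text \<open>A point that is not fixed has a nonzero component in the span of the two nontrivial
  eigenspaces, on which \<^const>\<open>turn\<close> acts by \<open>w\<close> and \<open>w\<inverse>\<close>, two numbers of the same order.\<close>

lemma turn_funpow_fixed_iff:
  assumes "w \<noteq> 0" "s = 1 + w + inverse w" "w\<^sup>2 \<noteq> 1" "turn s p \<noteq> p"
  shows "(turn s ^^ k) p = p \<longleftrightarrow> w ^ k = 1"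
proof
  assume "w ^ k = 1"
  then show "(turn s ^^ k) p = p" using turn_funpow_id[OF assms(1-3)] by simp
next
  assume fixed: "(turn s ^^ k) p = p"
  \<comment> \<open>Were both zero, \<open>turn s\<close> would preserve all three separating forms
    at p and hence fix p.\<close>
  have "eigenform w p \<noteq> 0 \<or> eigenform (inverse w) p \<noteq> 0"
  proof (rule ccontr)
    assume "\<not> ?thesis"
    then have "turn s p = p"
      using eigenform_turn[OF assms(1,2), of 1 p] eigenform_inverse_turn[OF assms(1,2), of 1 p]
        surface_form_turn[of s 1 p] assms(3)
      by (intro forms_separate[OF assms(1,2)]) simp_all
    with assms(4) show False by contradiction
  qed
  then show "w ^ k = 1"
    using eigenform_turn[OF assms(1,2), of k p] eigenform_inverse_turn[OF assms(1,2), of k p] fixed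
    by (auto simp: power_inverse)
qed

text \<open>At (t, t, t) the quadratic equation forces t = 0, and the linear one then reads 0 =
  1.\<close>

lemma surface_not_fixed:
  assumes "(x, y, z, s) \<in> monodromy_surface"
  shows "turn s (x, y, z) \<noteq> (x, y, z)"
  using assms by (auto simp: monodromy_surface_def algebra_simps)

section \<open>Orbit lengths and orders of roots of unity\<close>

lemma funpow_cancel:
  assumes "inj f" "i \<le> j" "(f ^^ i) p = (f ^^ j) p"
  shows "(f ^^ (j - i)) p = p"
proof -
  have "(f ^^ j) p = (f ^^ i) ((f ^^ (j - i)) p)"
    using funpow_add[of i "j - i" f] assms(2) by simp
  then show ?thesis
    using assms(3) inj_fn[OF assms(1)] by (metis injD)
qed

lemma inj_on_orbit_funpow:
  assumes "inj f" "\<And>k. (f ^^ k) p = p \<longleftrightarrow> n dvd k"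
  shows "inj_on (\<lambda>k. (f ^^ k) p) {..<n}"
proof (rule linorder_inj_onI)
  fix i j assume ij: "i < j" "i \<in> {..<n}" "j \<in> {..<n}"
  show "(f ^^ i) p \<noteq> (f ^^ j) p"
  proof
    assume "(f ^^ i) p = (f ^^ j) p"
    then have "(f ^^ (j - i)) p = p"
      using funpow_cancel[OF assms(1)] ij(1) by (simp add: less_imp_le)
    then have "n dvd j - i" using assms(2) by blast
    then show False using ij by (auto dest: dvd_imp_le)
  qed
qed auto

lemma cis_eq_1_iff: "cis t = 1 \<longleftrightarrow> (\<exists>n::int. t = of_int n * 2 * pi)"
proof
  assume "cis t = 1"
  then have "cos t = 1" by (metis cis.simps(1) one_complex.simps(1))
  then show "\<exists>n::int. t = of_int n * 2 * pi" by (simp add: cos_one_2pi_int)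
next
  assume "\<exists>n::int. t = of_int n * 2 * pi"
  then obtain n :: int where "t = 2 * pi * of_int n" by (auto simp: mult_ac)
  then show "cis t = 1" by (simp add: cis_multiple_2pi)
qed

text \<open>For r = a/b in lowest terms the power is 1 iff b divides k a, and coprimality removes
  a.\<close>

lemma cis_rat_power_eq_1_iff:
  "cis (2 * pi * of_rat r) ^ k = 1 \<longleftrightarrow> denominator r dvd k"
proof -
  obtain a b where ab: "quotient_of r = (a, b)" by (cases "quotient_of r")
  have b: "b > 0" and cop: "coprime a b" and r: "r = of_int a / of_int b"
    using ab by (auto dest: quotient_of_denom_pos quotient_of_coprime quotient_of_div)
  have rr: "(of_rat r :: real) = of_int a / of_int b" by (simp add: r of_rat_divide)
  have "cis (2 * pi * of_rat r) ^ k = 1 \<longleftrightarrow>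
      (\<exists>n::int. real k * (2 * pi * of_rat r) = of_int n * 2 * pi)"
    by (simp add: Complex.DeMoivre cis_eq_1_iff)
  also have "\<dots> \<longleftrightarrow> (\<exists>n::int. of_int (int k * a) = (of_int (n * b) :: real))"
    using b by (intro iff_exI) (auto simp: rr field_simps)
  also have "\<dots> \<longleftrightarrow> b dvd int k * a"
    unfolding of_int_eq_iff by (auto simp: dvd_def mult.commute)
  also have "\<dots> \<longleftrightarrow> b dvd int k"
    using cop by (simp add: coprime_commute coprime_dvd_mult_left_iff)
  also have "\<dots> \<longleftrightarrow> denominator r dvd k"
    using b ab by (auto simp: denominator_def nat_dvd_iff)
  finally show ?thesis .
qed

lemma denominator_pos: "0 < denominator r"
  using quotient_of_denom_pos'[of r] by (simp add: denominator_def)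

section \<open>Algebraicity of s\<close>

text \<open>The polynomials with \<open>p\<^sub>k (1 + w + w\<inverse>) = w\<^sup>k + w\<^sup>-\<^sup>k\<close>, that is, Chebyshev
  polynomials in the variable \<open>(s - 1) / 2\<close>.\<close>

fun chebyshev_like :: "nat \<Rightarrow> complex poly" where
  "chebyshev_like 0 = [:2:]"
| "chebyshev_like (Suc 0) = [:-1, 1:]"
| "chebyshev_like (Suc (Suc k)) = [:-1, 1:] * chebyshev_like (Suc k) - chebyshev_like k"

text \<open>\<open>[:-1, 1:]\<close> takes the value w + 1/w here, and multiplying the k-th power
  sum by w + 1/w gives the sum of its two neighbours.\<close>

lemma poly_chebyshev_like:
  assumes "w \<noteq> 0"
  shows "poly (chebyshev_like k) (1 + w + inverse w) = w ^ k + inverse w ^ k"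
  using assms
  by (induction k rule: chebyshev_like.induct) (simp_all add: field_simps)

lemma coeff_chebyshev_like: "coeff (chebyshev_like k) i \<in> \<int>"
proof (induction k arbitrary: i rule: chebyshev_like.induct)
  case (3 k)
  then show ?case by (simp add: coeff_pCons split: nat.split)
qed (simp_all add: coeff_pCons split: nat.split)

text \<open>When w^k = 1 the power sum is 2, so the trace is a root of
  \<open>chebyshev_like k - [:2:]\<close>, which has integer coefficients.\<close>

lemma algebraic_root_of_unity_trace:
  fixes w :: complex
  assumes "w \<noteq> 0" "w ^ k = 1" "0 < k"
  shows "algebraic (1 + w + inverse w)"
proof -
  let ?p = "chebyshev_like k - [:2:]"
  have "coeff ?p i \<in> \<int>" for i
    using coeff_chebyshev_like[of k i] by (simp add: coeff_pCons split: nat.split)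
  moreover have "poly ?p (1 + w + inverse w) = 0"
    using poly_chebyshev_like[OF assms(1), of k] assms(2) by (simp add: power_inverse)
  moreover have "?p \<noteq> 0"
  proof
    assume "?p = 0"
    \<comment> \<open>Evaluating at the trace of w = 2 shows that the polynomial is nonzero: 2^k +
      2^(-k) exceeds 2 for positive k.\<close>
    then have "poly ?p (1 + 2 + inverse 2) = 0" by simp
    then have "(2::complex) ^ k + inverse 2 ^ k = 2"
      using poly_chebyshev_like[of 2 k] by simp
    then have "of_real (2 ^ k + inverse 2 ^ k) = (of_real 2 :: complex)" by simp
    then have "(2::real) ^ k + inverse 2 ^ k = 2" using of_real_eq_iff by blast
    moreover have "2 + 0 < (2::real) ^ k + inverse 2 ^ k"
      using power_increasing[of 1 k "2::real"] assms(3) by (intro add_le_less_mono) simp_all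
    ultimately show False by simp
  qed
  ultimately show ?thesis by (intro algebraicI)
qed

section \<open>From a finite group to a rational angle\<close>

lemma exists_eigenvalue: "\<exists>w::complex. w \<noteq> 0 \<and> s = 1 + w + inverse w"
proof -
  \<comment> \<open>Quadratic formula for w^2 - (s - 1) w + 1 = 0; the other root is 1/w.\<close>
  define r where "r = csqrt ((s - 1)\<^sup>2 - 4)"
  define w where "w = ((s - 1) + r) / 2"
  have "r\<^sup>2 = (s - 1)\<^sup>2 - 4" by (simp add: r_def)
  then have w: "w * (s - 1 - w) = 1"
    by (simp add: w_def field_simps power2_eq_square)
  then have "w \<noteq> 0" by auto
  moreover have "inverse w = s - 1 - w" using w by (rule inverse_unique)
  ultimately show ?thesis by (intro exI[of _ w]) simp
qed

lemma cis_trace: "1 + cis t + inverse (cis t) = complex_of_real (1 + 2 * cos t)"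
  by (simp add: complex_eq_iff)

text \<open>Write w = exp(2 \<pi> i q) with q in [0, 1). The values 0 and 1/2 belong to w =
  \<plusminus>1, and for q > 1/2 the angle 1 - q has the same cosine.\<close>

lemma root_of_unity_trace:
  assumes "w ^ k = 1" "0 < k" "w\<^sup>2 \<noteq> 1"
  shows "\<exists>r::rat. 0 < 2 * r \<and> 2 * r < 1 \<and>
    1 + w + inverse w = complex_of_real (1 + 2 * cos (2 * pi * of_rat r))"
proof -
  obtain j where j: "j < k" and w: "w = cis (2 * pi * real j / real k)"
    using bij_betw_roots_unity[OF assms(2)] assms(1) unfolding bij_betw_def by blast
  define q :: rat where "q = of_nat j / of_nat k"
  have wq: "w = cis (2 * pi * of_rat q)" by (simp add: w q_def of_rat_divide)
  have tr: "1 + w + inverse w = complex_of_real (1 + 2 * cos (2 * pi * of_rat q))"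
    unfolding wq by (rule cis_trace)
  have q: "0 \<le> q" "q < 1" using j by (simp_all add: q_def)
  have "q \<noteq> 0" using assms(3) wq by auto
  have "q \<noteq> 1 / 2"
  proof
    assume "q = 1 / 2"
    then have "of_rat q = (1 / 2 :: real)" by (simp only: of_rat_divide of_rat_1 of_rat_numeral_eq)
    then have "2 * pi * of_rat q = pi" by simp
    then have "w = cis pi" using wq by (simp only:)
    then have "w = -1" by simp
    then show False using assms(3) by simp
  qed
  show ?thesis
  proof (cases "2 * q < 1")
    case True
    then show ?thesis using tr q \<open>q \<noteq> 0\<close> by (intro exI[of _ q]) auto
  next
    case False
    have "2 * pi * of_rat (1 - q) = 2 * pi - 2 * pi * of_rat q"
      by (simp add: of_rat_diff algebra_simps)
    then have "cos (2 * pi * of_rat (1 - q)) = cos (2 * pi * of_rat q)"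
      by (simp add: cos_diff)
    then show ?thesis using tr q False \<open>q \<noteq> 1 / 2\<close> by (intro exI[of _ "1 - q"]) auto
  qed
qed

text \<open>By pigeonhole two powers of \<open>turn s\<close> coincide, and injectivity turns this
  into a period, which makes the eigenvalue a root of unity.\<close>

lemma finite_D12_at_imp:
  assumes "finite (D12_at s)"
  shows "algebraic s \<and> (\<exists>r::rat. 0 < 2 * r \<and> 2 * r < 1 \<and>
    s = complex_of_real (1 + 2 * cos (2 * pi * of_rat r)))"
proof -
  have "finite (range (\<lambda>k. turn s ^^ k))"
    using assms turn_funpow_in_D12_at by (meson finite_subset image_subsetI)
  then have "\<not> inj (\<lambda>k. turn s ^^ k)" using finite_imageD infinite_UNIV_nat by blast
  then obtain i j where ij: "i < j" "turn s ^^ i = turn s ^^ j"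
    unfolding inj_def by (metis nat_neq_iff)
  have "turn s ^^ (j - i) = id"
  proof
    fix p
    show "(turn s ^^ (j - i)) p = id p"
      using funpow_cancel[OF inj_turn, of i j s p] ij by simp
  qed
  moreover obtain w where w: "w \<noteq> 0" "s = 1 + w + inverse w" using exists_eigenvalue by blast
  ultimately have "w ^ (j - i) = 1" "w\<^sup>2 \<noteq> 1"
    using turn_periodic_imp_root[OF w] ij(1) by auto
  then show ?thesis
    using algebraic_root_of_unity_trace[of w "j - i"] root_of_unity_trace[of w "j - i"] w ij(1)
    by simp
qed

section \<open>From a rational angle to a finite group\<close>

context
  fixes r :: rat and s w :: complex
  assumes r: "0 < 2 * r" "2 * r < 1"
    and s: "s = complex_of_real (1 + 2 * cos (2 * pi * of_rat r))"
  defines "w \<equiv> cis (2 * pi * of_rat r)"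
begin

lemma eigenvalue: "w \<noteq> 0" "s = 1 + w + inverse w"
  unfolding s w_def by (simp, rule cis_trace[symmetric])

text \<open>Otherwise \<open>2 * r\<close> would be an integer strictly between 0 and 1.\<close>

lemma eigenvalue_square: "w\<^sup>2 \<noteq> 1"
proof
  assume "w\<^sup>2 = 1"
  then have "cis (2 * (2 * pi * of_rat r)) = 1" by (simp add: w_def Complex.DeMoivre)
  then obtain n :: int where "2 * (2 * pi * of_rat r) = of_int n * 2 * pi"
    using cis_eq_1_iff by blast
  then have "of_rat (2 * r) = (of_rat (of_int n) :: real)" by (simp add: of_rat_mult)
  then have "2 * r = of_int n" using of_rat_eq_iff by blast
  then show False using r by simp
qed

lemma turn_period: "turn s ^^ denominator r = id"
  using turn_funpow_id[OF eigenvalue eigenvalue_square] cis_rat_power_eq_1_iff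
  by (simp add: w_def)

lemma inj_on_turn_orbit:
  assumes "turn s p \<noteq> p"
  shows "inj_on (\<lambda>k. (turn s ^^ k) p) {..<denominator r}"
  using turn_funpow_fixed_iff[OF eigenvalue eigenvalue_square assms]
  by (intro inj_on_orbit_funpow inj_turn) (simp add: w_def cis_rat_power_eq_1_iff)

lemma N12_at_eq: "N12_at s = (\<lambda>k. turn s ^^ k) ` {..<denominator r}"
  using N12_at_periodic[OF turn_period denominator_pos]
    funpow_periodic[OF turn_period denominator_pos] by simp

lemma finite_D12_at: "finite (D12_at s)"
  by (rule finite_D12_at_periodic[OF turn_period denominator_pos])

lemma card_N12_at: "card (N12_at s) = denominator r"
proof -
  \<comment> \<open>\<open>turn s\<close> moves (0, 1, 0) to (1, 0, 0), so the images of this one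
    point already distinguish the powers.\<close>
  have "inj_on (\<lambda>k. (turn s ^^ k) (0, 1, 0)) {..<denominator r}"
    by (rule inj_on_turn_orbit) simp
  then have "inj_on (\<lambda>k. turn s ^^ k) {..<denominator r}"
    by (auto simp: inj_on_def)
  then show ?thesis by (simp add: N12_at_eq card_image)
qed

lemma card_orbit_N12:
  assumes "(x, y, z, s) \<in> monodromy_surface"
  shows "card (orbit N12 (slice s) (x, y, z)) = denominator r"
proof -
  have "orbit N12 (slice s) (x, y, z) = (\<lambda>f. f (x, y, z)) ` N12_at s"
    by (auto simp: orbit_def N12_at_def)
  also have "\<dots> = (\<lambda>k. (turn s ^^ k) (x, y, z)) ` {..<denominator r}"
    by (simp add: N12_at_eq image_image)
  finally show ?thesis
    using inj_on_turn_orbit[OF surface_not_fixed[OF assms]] by (simp add: card_image)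
qed

end

text \<open>Orbit length is read both as the order of the restricted normal subgroup and as the size
  of each orbit on the surface; the two agree because no surface point is fixed by the
  rotation.\<close>

theorem proposition5p3:
  fixes s\<^sub>0 :: complex
  shows
    "(finite (D12_at s\<^sub>0) \<longleftrightarrow>
        algebraic s\<^sub>0 \<and>
        (\<exists>\<rho> \<rho>\<^sub>1 :: rat. branching_parameter \<rho> \<and> \<rho>\<^sub>1 = 1 / 2 - \<rho> \<and>
           0 < 2 * \<rho>\<^sub>1 \<and> 2 * \<rho>\<^sub>1 < 1 \<and>
           s\<^sub>0 = complex_of_real (1 + 2 * cos (2 * pi * of_rat \<rho>\<^sub>1)))) \<and>
     (\<forall>\<rho> \<rho>\<^sub>1 :: rat. branching_parameter \<rho> \<and> \<rho>\<^sub>1 = 1 / 2 - \<rho> \<and>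
           0 < 2 * \<rho>\<^sub>1 \<and> 2 * \<rho>\<^sub>1 < 1 \<and>
           s\<^sub>0 = complex_of_real (1 + 2 * cos (2 * pi * of_rat \<rho>\<^sub>1)) \<longrightarrow>
        card (N12_at s\<^sub>0) = denominator \<rho>\<^sub>1 \<and>
        (\<forall>x y z. (x, y, z, s\<^sub>0) \<in> monodromy_surface \<longrightarrow>
           card (orbit N12 (slice s\<^sub>0) (x, y, z)) = denominator \<rho>\<^sub>1))"
proof (intro conjI iffI)
  assume fin: "finite (D12_at s\<^sub>0)"
  show "algebraic s\<^sub>0" using finite_D12_at_imp[OF fin] by blast
  obtain r :: rat where r: "0 < 2 * r" "2 * r < 1"
      "s\<^sub>0 = complex_of_real (1 + 2 * cos (2 * pi * of_rat r))"
    using finite_D12_at_imp[OF fin] by blast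
  then show "\<exists>\<rho> \<rho>\<^sub>1 :: rat. branching_parameter \<rho> \<and> \<rho>\<^sub>1 = 1 / 2 - \<rho> \<and>
      0 < 2 * \<rho>\<^sub>1 \<and> 2 * \<rho>\<^sub>1 < 1 \<and> s\<^sub>0 = complex_of_real (1 + 2 * cos (2 * pi * of_rat \<rho>\<^sub>1))"
    by (intro exI[of _ "1 / 2 - r"] exI[of _ r]) (simp add: branching_parameter_iff)
next
  assume "algebraic s\<^sub>0 \<and> (\<exists>\<rho> \<rho>\<^sub>1 :: rat. branching_parameter \<rho> \<and> \<rho>\<^sub>1 = 1 / 2 - \<rho> \<and>
      0 < 2 * \<rho>\<^sub>1 \<and> 2 * \<rho>\<^sub>1 < 1 \<and>
      s\<^sub>0 = complex_of_real (1 + 2 * cos (2 * pi * of_rat \<rho>\<^sub>1)))"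
  then show "finite (D12_at s\<^sub>0)" by (elim conjE exE) (rule finite_D12_at)
qed (intro allI impI conjI; elim conjE; rule card_N12_at card_orbit_N12; assumption)

end
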